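(* Let $\Gamma$ be an infinite abelian group and $F\colon\Gamma\to\Gamma$ an injective endomorphism, and suppose $\Gamma$ admits an $F^r$-spanning set for some $r>0$. Let $S\subseteq\Gamma$ be a finite set containing a representative of each coset of $F\Gamma$ in $\Gamma$. Then a subset $A\subseteq\Gamma$ is $F$-automatic if and only if the $(S,F)$-kernel of $A$ is finite.
   Context: For a string $\sigma=s_0\cdots s_n$ of elements of $\Gamma$ and an endomorphism $G$, $[\sigma]_G=s_0+Gs_1+\cdots+G^ns_n$. $\Lambda^*$ denotes finite strings over $\Lambda$. A finite $\Sigma\subseteq\Gamma$ is a $G$-spanning set if: (i) every $a\in\Gamma$ equals $[\sigma]_G$ for some $\sigma\in\Sigma^*$; (ii) $0\in\Sigma$ and $\Sigma=-\Sigma$; (iii) for $a_1,\dots,a_5\in\Sigma$, $a_1+\cdots+a_5\in\Sigma+G\Sigma$; (iv) if $a_1,a_2,a_3\in\Sigma$ and $a_1+a_2+a_3\in G\Gamma$ then $a_1+a_2+a_3\in G\Sigma$. $A\subseteq\Gamma$ is $F$-automatic if there are $r>0$ and an $F^r$-spanning set $\Sigma$ such that $\{\sigma\in\Sigma^*:[\sigma]_{F^r}\in A\}$ is a regular language over the alphabet $\Sigma$. For $A\subseteq\Gamma$ and $s_0,\dots,s_{n-1}\in\Gamma$, let $A_{s_0\cdots s_{n-1}}=\{x\in\Gamma: s_0+Fs_1+\cdots+F^{n-1}s_{n-1}+F^nx\in A\}$ (so $A_\epsilon=A$ for the empty string). The $(S,F)$-kernel of $A$ is $\{A_\sigma:\sigma\in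 S^*\}$. *)

theory Defs
  imports Complex_Main
begin

text \<open>
  The group \<open>\<Gamma>\<close> is the whole of a type \<open>'a\<close> of class \<^class>\<open>ab_group_add\<close>, so \<open>F\<Gamma>\<close> is
  \<open>range F\<close> and \<open>\<Sigma>\<^sup>*\<close> is \<open>lists \<Sigma>\<close>. Endomorphisms are functions satisfying the locale
  predicate \<open>additive\<close>.
\<close>

definition expansion_value :: "('a \<Rightarrow> 'a) \<Rightarrow> 'a list \<Rightarrow> 'a::ab_group_add" where
  "expansion_value G \<sigma> = (\<Sum>i<length \<sigma>. (G ^^ i) (\<sigma> ! i))"

definition spanning_set :: "('a \<Rightarrow> 'a) \<Rightarrow> 'a::ab_group_add set \<Rightarrow> bool" where
  "spanning_set G \<Sigma> \<longleftrightarrow>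
     finite \<Sigma> \<and>
     (\<forall>a. \<exists>\<sigma>\<in>lists \<Sigma>. a = expansion_value G \<sigma>) \<and>
     0 \<in> \<Sigma> \<and> \<Sigma> = uminus ` \<Sigma> \<and>
     (\<forall>a\<^sub>1\<in>\<Sigma>. \<forall>a\<^sub>2\<in>\<Sigma>. \<forall>a\<^sub>3\<in>\<Sigma>. \<forall>a\<^sub>4\<in>\<Sigma>. \<forall>a\<^sub>5\<in>\<Sigma>.
        \<exists>b\<in>\<Sigma>. \<exists>c\<in>\<Sigma>. a\<^sub>1 + a\<^sub>2 + a\<^sub>3 + a\<^sub>4 + a\<^sub>5 = b + G c) \<and>
     (\<forall>a\<^sub>1\<in>\<Sigma>. \<forall>a\<^sub>2\<in>\<Sigma>. \<forall>a\<^sub>3\<in>\<Sigma>.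
        a\<^sub>1 + a\<^sub>2 + a\<^sub>3 \<in> range G \<longrightarrow> a\<^sub>1 + a\<^sub>2 + a\<^sub>3 \<in> G ` \<Sigma>)"

text \<open>
  Regularity is recognition by a deterministic finite automaton over the alphabet \<open>\<Sigma>\<close>.
  Taking the states to be natural numbers loses no generality, since there are only finitely
  many of them.
\<close>

definition regular_language :: "'a set \<Rightarrow> 'a list set \<Rightarrow> bool" where
  "regular_language \<Sigma> L \<longleftrightarrow>
     (\<exists>(Q :: nat set) q\<^sub>0 \<delta> Acc.
        finite Q \<and> q\<^sub>0 \<in> Q \<and> Acc \<subseteq> Q \<and> (\<forall>q\<in>Q. \<forall>a\<in>\<Sigma>. \<delta> q a \<in> Q) \<and>
        L = {w \<in> lists \<Sigma>. foldl \<delta> q\<^sub>0 w \<in> Acc})"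

definition automatic :: "('a \<Rightarrow> 'a) \<Rightarrow> 'a::ab_group_add set \<Rightarrow> bool" where
  "automatic F A \<longleftrightarrow>
     (\<exists>r>0. \<exists>\<Sigma>. spanning_set (F ^^ r) \<Sigma> \<and>
        regular_language \<Sigma> {\<sigma> \<in> lists \<Sigma>. expansion_value (F ^^ r) \<sigma> \<in> A})"

definition kernel_set :: "('a \<Rightarrow> 'a) \<Rightarrow> 'a::ab_group_add set \<Rightarrow> 'a list \<Rightarrow> 'a set" where
  "kernel_set F A \<sigma> = {x. expansion_value F \<sigma> + (F ^^ length \<sigma>) x \<in> A}"

definition digit_kernel :: "'a set \<Rightarrow> ('a \<Rightarrow> 'a) \<Rightarrow> 'a::ab_group_add set \<Rightarrow> 'a set set" where
  "digit_kernel S F A = kernel_set F A ` lists S"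

end

theory Submission
  imports Defs
begin

text \<open>
  For a spanning set \<open>\<Sigma>\<close> of \<open>G = F\<^sup>r\<close>, the sets \<open>{x. [\<sigma>]\<^sub>G + G\<^sup>n x \<in> A}\<close> with
  \<open>\<sigma> \<in> \<Sigma>\<^sup>n\<close> are the Myhill--Nerode classes of \<open>{\<sigma>. [\<sigma>]\<^sub>G \<in> A}\<close>, so this language is regular iff
  the \<open>(\<Sigma>, G)\<close>-kernel of \<open>A\<close> is finite. Finiteness of the kernel does not change when \<open>\<Sigma>\<close> is
  replaced by the set \<open>T\<close> of values of strings in \<open>S\<^sup>r\<close>: a string over one of the two digit sets is
  rewritten over the other by a left-to-right pass whose carry stays in the finite set \<open>D\<^sub>n\<close> of
  values of strings in \<open>\<Sigma>\<^sup>n\<close>, for large \<open>n\<close>. Both directions rest on \<open>\<Sigma> + D\<^sub>n + D\<^sub>n \<subseteq> D\<^sub>n\<^sub>+\<^sub>1\<close>,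
  which follows from (iii); the rewriting from \<open>\<Sigma>\<close> to \<open>T\<close> also needs (iv) for the lowest digit.
  Finally the \<open>(T, G)\<close>-kernel consists of the members of the \<open>(S, F)\<close>-kernel indexed by strings of
  length divisible by \<open>r\<close>.
\<close>

section \<open>Values and kernels of concatenated strings\<close>

lemma additive_funpow:
  fixes F :: "'a::ab_group_add \<Rightarrow> 'a"
  assumes "additive F"
  shows "additive (F ^^ n)"
  by (rule additive.intro, induction n) (simp_all add: additive.add[OF assms])

lemma expansion_value_Nil [simp]: "expansion_value G [] = 0"
  by (simp add: expansion_value_def)

lemma expansion_value_Cons:
  assumes "additive G"
  shows "expansion_value G (a # \<sigma>) = a + G (expansion_value G \<sigma>)"
  unfolding expansion_value_def
  by (simp add: sum.lessThan_Suc_shift additive.sum[OF assms] del: sum.lessThan_Suc)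

lemma expansion_value_append:
  assumes "additive G"
  shows "expansion_value G (\<sigma> @ \<tau>) = expansion_value G \<sigma> + (G ^^ length \<sigma>) (expansion_value G \<tau>)"
  by (induction \<sigma>) (simp_all add: expansion_value_Cons[OF assms] additive.add[OF assms] add.assoc)

lemma expansion_value_concat:
  assumes "additive F" "\<forall>b\<in>set bs. length b = r"
  shows "expansion_value F (concat bs) = expansion_value (F ^^ r) (map (expansion_value F) bs)"
  using assms(2)
  by (induction bs)
    (auto simp: expansion_value_append[OF assms(1)]
      expansion_value_Cons[OF additive_funpow[OF assms(1)]])

lemma kernel_set_Nil [simp]: "kernel_set F A [] = A"
  by (simp add: kernel_set_def)

lemma kernel_set_append:
  assumes "additive F"
  shows "kernel_set F A (\<sigma> @ \<tau>) = kernel_set F (kernel_set F A \<sigma>) \<tau>"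
  by (simp add: kernel_set_def expansion_value_append[OF assms] funpow_add add.assoc
      additive.add[OF additive_funpow[OF assms]])

text \<open>This lets a block of \<open>r\<close> digits for \<open>F\<close> be read as one digit
  for \<open>F ^^ r\<close>.\<close>

lemma kernel_set_concat:
  assumes "additive F" "\<forall>b\<in>set bs. length b = r"
  shows "kernel_set F A (concat bs) = kernel_set (F ^^ r) A (map (expansion_value F) bs)"
proof -
  have "length (concat bs) = r * length bs"
    using assms(2) by (induction bs) auto
  then show ?thesis
    by (simp add: kernel_set_def expansion_value_concat[OF assms] funpow_mult mult.commute)
qed

section \<open>Elements with expansions of fixed length\<close>

text \<open>It plays two roles: over a spanning set these are the bounded carry sets, and over
  \<open>S\<close> with \<open>n = r\<close> it is the digit set for \<open>F ^^ r\<close> built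
  from blocks.\<close>

definition expansions :: "('a \<Rightarrow> 'a) \<Rightarrow> 'a set \<Rightarrow> nat \<Rightarrow> 'a::ab_group_add set" where
  "expansions G \<Sigma> n = expansion_value G ` {\<sigma> \<in> lists \<Sigma>. length \<sigma> = n}"

lemma finite_expansions: "finite \<Sigma> \<Longrightarrow> finite (expansions G \<Sigma> n)"
  unfolding expansions_def
  using finite_lists_length_eq[of \<Sigma> n] by (simp add: in_lists_conv_set subset_eq)

lemma expansions_0 [simp]: "expansions G \<Sigma> 0 = {0}"
  by (auto simp: expansions_def)

lemma expansions_Suc:
  assumes "additive G"
  shows "expansions G \<Sigma> (Suc n) = {a + G x |a x. a \<in> \<Sigma> \<and> x \<in> expansions G \<Sigma> n}"
    (is "?L = ?R")
proof
  show "?L \<subseteq> ?R"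
    by (fastforce simp: expansions_def length_Suc_conv expansion_value_Cons[OF assms])
  show "?R \<subseteq> ?L"
  proof clarify
    fix a x assume "a \<in> \<Sigma>" "x \<in> expansions G \<Sigma> n"
    then obtain \<sigma> where "\<sigma> \<in> lists \<Sigma>" "length \<sigma> = n" "x = expansion_value G \<sigma>"
      by (auto simp: expansions_def)
    with \<open>a \<in> \<Sigma>\<close> show "a + G x \<in> ?L"
      unfolding expansions_def
      by (intro image_eqI[of _ _ "a # \<sigma>"]) (auto simp: expansion_value_Cons[OF assms])
  qed
qed

lemma zero_in_expansions:
  assumes "additive G" "0 \<in> \<Sigma>"
  shows "0 \<in> expansions G \<Sigma> n"
proof (induction n)
  case (Suc n)
  have "0 + G 0 = 0" by (simp add: additive.zero[OF assms(1)])
  with Suc assms(2) show ?case unfolding expansions_Suc[OF assms(1)] by force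
qed simp

lemma expansions_mono:
  assumes "additive G" "0 \<in> \<Sigma>" "m \<le> n"
  shows "expansions G \<Sigma> m \<subseteq> expansions G \<Sigma> n"
proof -
  have "expansions G \<Sigma> k \<subseteq> expansions G \<Sigma> (Suc k)" for k
  proof (induction k)
    case 0
    show ?case using zero_in_expansions[OF assms(1,2)] by simp
  next
    case (Suc k)
    then show ?case
      unfolding expansions_Suc[OF assms(1), of _ k] expansions_Suc[OF assms(1), of _ "Suc k"]
      by blast
  qed
  then show ?thesis using lift_Suc_mono_le[of "expansions G \<Sigma>"] assms(3) by blast
qed

text \<open>By (i) each element has an expansion of some length. As 0 is a digit, the sets grow with
  the length, so a maximum of the lengths works.\<close>

lemma finite_subset_expansions:
  assumes "additive G" "spanning_set G \<Sigma>" "finite T"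
  obtains n where "T \<subseteq> expansions G \<Sigma> n"
proof -
  have zero: "0 \<in> \<Sigma>" and all: "\<forall>a. \<exists>\<sigma>\<in>lists \<Sigma>. a = expansion_value G \<sigma>"
    using assms(2) by (auto simp: spanning_set_def)
  have "\<exists>n. T \<subseteq> expansions G \<Sigma> n"
    using assms(3)
  proof (induction T)
    case (insert x T)
    then obtain m where m: "T \<subseteq> expansions G \<Sigma> m" by blast
    obtain n where "x \<in> expansions G \<Sigma> n"
      using all by (fastforce simp: expansions_def)
    with m expansions_mono[OF assms(1) zero, of m "max m n"]
      expansions_mono[OF assms(1) zero, of n "max m n"]
    show ?case by (intro exI[of _ "max m n"]) auto
  qed simp
  then show ?thesis using that by blast
qed

section \<open>Carries and change of digit set\<close>

text \<open>This is column addition with incoming carry \<open>t\<close>: by (iii) the carry out of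
  each column is again one digit, and the last carry becomes the extra top digit.\<close>

lemma carry_add_expansions:
  assumes "additive G" "spanning_set G \<Sigma>"
    and "t \<in> \<Sigma>" "x \<in> expansions G \<Sigma> n" "y \<in> expansions G \<Sigma> n"
  shows "t + x + y \<in> expansions G \<Sigma> (Suc n)"
  using assms(3-)
proof (induction n arbitrary: t x y)
  case 0
  have "t = t + G 0" by (simp add: additive.zero[OF assms(1)])
  with 0 show ?case by (auto simp: expansions_Suc[OF assms(1)])
next
  case (Suc n)
  obtain a x' where x: "a \<in> \<Sigma>" "x' \<in> expansions G \<Sigma> n" "x = a + G x'"
    using Suc.prems by (auto simp: expansions_Suc[OF assms(1)])
  obtain b y' where y: "b \<in> \<Sigma>" "y' \<in> expansions G \<Sigma> n" "y = b + G y'"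
    using Suc.prems by (auto simp: expansions_Suc[OF assms(1)])
  have zero: "0 \<in> \<Sigma>" and five: "\<forall>a\<^sub>1\<in>\<Sigma>. \<forall>a\<^sub>2\<in>\<Sigma>. \<forall>a\<^sub>3\<in>\<Sigma>. \<forall>a\<^sub>4\<in>\<Sigma>. \<forall>a\<^sub>5\<in>\<Sigma>.
        \<exists>b\<in>\<Sigma>. \<exists>c\<in>\<Sigma>. a\<^sub>1 + a\<^sub>2 + a\<^sub>3 + a\<^sub>4 + a\<^sub>5 = b + G c"
    using assms(2) by (auto simp: spanning_set_def)
  \<comment> \<open>Two zeros pad the lowest column to the five summands of (iii); \<open>u\<close>
    is the carry into the next column.\<close>
  have "\<exists>d\<in>\<Sigma>. \<exists>u\<in>\<Sigma>. t + a + b + 0 + 0 = d + G u"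
    using five \<open>t \<in> \<Sigma>\<close> x(1) y(1) zero by blast
  then obtain d u where du: "d \<in> \<Sigma>" "u \<in> \<Sigma>" "t + a + b = d + G u"
    by auto
  have "t + x + y = (t + a + b) + G (x' + y')"
    by (simp add: x y additive.add[OF assms(1)] algebra_simps)
  also have "\<dots> = d + G (u + x' + y')"
    unfolding du by (simp add: additive.add[OF assms(1)] add.assoc)
  finally show ?case
    using Suc.IH[OF du(2) x(2) y(2)] du(1)
    unfolding expansions_Suc[OF assms(1), of _ "Suc n"] by blast
qed

text \<open>The pass starts at the lowest digit. The final carry is not expanded further but kept as
  \<open>c'\<close>, so that both strings have the same length.\<close>

lemma expansion_value_carry:
  assumes "additive G" and carry: "\<forall>t\<in>T. \<forall>c\<in>C. \<exists>u\<in>U. \<exists>c'\<in>C. t + c = u + G c'"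
    and "\<sigma> \<in> lists T" "c \<in> C"
  shows "\<exists>\<tau>\<in>lists U. \<exists>c'\<in>C. length \<tau> = length \<sigma> \<and>
           expansion_value G \<sigma> + c = expansion_value G \<tau> + (G ^^ length \<sigma>) c'"
  using assms(3,4)
proof (induction arbitrary: c)
  case Nil
  then show ?case by (intro bexI[of _ "[]"] bexI[of _ c]) auto
next
  case (Cons t \<sigma>)
  obtain u c' where u: "u \<in> U" "c' \<in> C" "t + c = u + G c'"
    using carry Cons.hyps(1) Cons.prems by blast
  obtain \<tau> d where \<tau>: "\<tau> \<in> lists U" "d \<in> C" "length \<tau> = length \<sigma>"
    "expansion_value G \<sigma> + c' = expansion_value G \<tau> + (G ^^ length \<sigma>) d"
    using Cons.IH[OF u(2)] by blast
  have "expansion_value G (t # \<sigma>) + c = (t + c) + G (expansion_value G \<sigma>)"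
    by (simp add: expansion_value_Cons[OF assms(1)] algebra_simps)
  also have "\<dots> = u + G (expansion_value G \<sigma> + c')"
    unfolding u by (simp add: additive.add[OF assms(1)] algebra_simps)
  also have "\<dots> = expansion_value G (u # \<tau>) + (G ^^ length (t # \<sigma>)) d"
    unfolding \<tau> by (simp add: additive.add[OF assms(1)] expansion_value_Cons[OF assms(1)] add.assoc)
  finally show ?case
    using u \<tau> by (intro bexI[of _ "u # \<tau>"] bexI[of _ d]) auto
qed

text \<open>Rewriting from carry 0 shows that each kernel set over \<open>T\<close> is a translate,
  by the final carry, of a kernel set over \<open>U\<close>; there are finitely many such
  pairs.\<close>

lemma finite_digit_kernel_carry:
  assumes "additive G" and "finite C" "0 \<in> C"
    and carry: "\<forall>t\<in>T. \<forall>c\<in>C. \<exists>u\<in>U. \<exists>c'\<in>C. t + c = u + G c'"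
    and fin: "finite (digit_kernel U G A)"
  shows "finite (digit_kernel T G A)"
proof -
  have "digit_kernel T G A \<subseteq> (\<lambda>(B, c). {x. c + x \<in> B}) ` (digit_kernel U G A \<times> C)"
  proof
    fix B assume "B \<in> digit_kernel T G A"
    then obtain \<sigma> where \<sigma>: "\<sigma> \<in> lists T" "B = kernel_set G A \<sigma>"
      by (auto simp: digit_kernel_def)
    obtain \<tau> c where \<tau>: "\<tau> \<in> lists U" "c \<in> C" "length \<tau> = length \<sigma>"
      "expansion_value G \<sigma> = expansion_value G \<tau> + (G ^^ length \<sigma>) c"
      using expansion_value_carry[OF assms(1) carry \<sigma>(1) assms(3)] by auto
    have "B = {x. c + x \<in> kernel_set G A \<tau>}"
      by (simp add: \<sigma>(2) kernel_set_def \<tau>(3,4) additive.add[OF additive_funpow[OF assms(1)]] add.assoc)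
    then show "B \<in> (\<lambda>(B, c). {x. c + x \<in> B}) ` (digit_kernel U G A \<times> C)"
      using \<tau>(1,2) by (intro image_eqI[of _ _ "(kernel_set G A \<tau>, c)"]) (auto simp: digit_kernel_def)
  qed
  then show ?thesis
    using fin assms(2) by (meson finite_SigmaI finite_imageI finite_subset)
qed

lemma finite_digit_kernel_spanning_iff:
  assumes "additive G" "spanning_set G \<Sigma>"
    and "finite T" and rep: "\<forall>x. \<exists>t\<in>T. t - x \<in> range G"
  shows "finite (digit_kernel \<Sigma> G A) \<longleftrightarrow> finite (digit_kernel T G A)"
proof -
  have zero: "0 \<in> \<Sigma>" and "finite \<Sigma>"
    and three: "\<forall>a\<^sub>1\<in>\<Sigma>. \<forall>a\<^sub>2\<in>\<Sigma>. \<forall>a\<^sub>3\<in>\<Sigma>. a\<^sub>1 + a\<^sub>2 + a\<^sub>3 \<in> range G \<longrightarrow> a\<^sub>1 + a\<^sub>2 + a\<^sub>3 \<in> G ` \<Sigma>"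
    using assms(2) by (auto simp: spanning_set_def)
  note Suc = expansions_Suc[OF assms(1)]
  obtain m where m: "T \<union> uminus ` T \<subseteq> expansions G \<Sigma> m"
    using finite_subset_expansions[OF assms(1,2), of "T \<union> uminus ` T"] assms(3) by auto
  \<comment> \<open>The index exceeds \<open>m\<close> by one so that elements of \<open>C\<close>
    split off a lowest digit, leaving a tail of length \<open>m\<close>; adding two such tails and a
    carry digit lands in \<open>C\<close> again.\<close>
  define C where "C = expansions G \<Sigma> (Suc m)"
  have T: "T \<subseteq> C" "uminus ` T \<subseteq> C"
    using m expansions_mono[OF assms(1) zero, of m "Suc m"] by (auto simp: C_def)
  have C: "finite C" "0 \<in> C"
    using finite_expansions[OF \<open>finite \<Sigma>\<close>] zero_in_expansions[OF assms(1) zero]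
    by (auto simp: C_def)
  have "\<exists>u\<in>\<Sigma>. \<exists>c'\<in>C. t + c = u + G c'" if "t \<in> T" "c \<in> C" for t c
  proof -
    \<comment> \<open>Both \<open>t\<close> and \<open>c\<close> lie in \<open>C\<close>. The sum
      needs one more digit, and dropping its lowest digit leaves the new carry in
      \<open>C\<close>.\<close>
    have "0 + t + c \<in> expansions G \<Sigma> (Suc (Suc m))"
      using that T by (intro carry_add_expansions assms zero) (auto simp: C_def)
    then show ?thesis by (auto simp: C_def Suc[of _ "Suc m"])
  qed
  moreover have "\<exists>u\<in>T. \<exists>c'\<in>C. a + c = u + G c'" if a: "a \<in> \<Sigma>" and c_mem: "c \<in> C" for a c
  proof -
    \<comment> \<open>The output digit must be congruent to \<open>a + c\<close> modulo
      \<open>range G\<close>; the new carry is the quotient of \<open>a + c - t\<close> by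
      \<open>G\<close>.\<close>
    obtain t z where t: "t \<in> T" "t - (a + c) = G z"
      using rep by blast
    obtain c0 x where c: "c0 \<in> \<Sigma>" "x \<in> expansions G \<Sigma> m" "c = c0 + G x"
      using c_mem by (auto simp: C_def Suc)
    have "- t \<in> C" using t T by auto
    then obtain t0 y where t': "t0 \<in> \<Sigma>" "y \<in> expansions G \<Sigma> m" "- t = t0 + G y"
      by (auto simp: C_def Suc)
    \<comment> \<open>Only lowest digits matter modulo \<open>range G\<close>, so this sum of three
      digits of \<Sigma> is divisible by \<open>G\<close>, and (iv) makes its quotient a single
      digit \<open>u\<close>. The new carry is then \<open>u + x + y\<close>.\<close>
    have "a + c0 + t0 = a + c + (- t) - G x - G y"
      by (simp add: c t')
    also have "\<dots> = - G z - G x - G y"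
      unfolding t(2)[symmetric] by simp
    also have "\<dots> = G (- z - x - y)"
      by (simp add: additive.minus[OF assms(1)] additive.diff[OF assms(1)])
    finally have "a + c0 + t0 \<in> range G" by simp
    then obtain u where u: "u \<in> \<Sigma>" "a + c0 + t0 = G u"
      using three a c(1) t'(1) by blast
    have "a + c = t + (a + c + (- t))" by simp
    also have "a + c + (- t) = (a + c0 + t0) + G x + G y"
      by (simp add: c t')
    also have "\<dots> = G (u + x + y)"
      by (simp add: u additive.add[OF assms(1)])
    finally show ?thesis
      using carry_add_expansions[OF assms(1,2) u(1) c(2) t'(2)] t(1) by (auto simp: C_def)
  qed
  ultimately show ?thesis
    using finite_digit_kernel_carry[OF assms(1) C] by (meson)
qed

section \<open>Passing between \<open>F\<close> and its powers\<close>

text \<open>Blocks are cut from the low-order end, so the short remainder comes last and acts on a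
  kernel set already reached by whole blocks.\<close>

lemma exists_block_decomposition:
  assumes "0 < r" "\<sigma> \<in> lists S"
  shows "\<exists>bs \<tau>. \<sigma> = concat bs @ \<tau> \<and> bs \<in> lists {b \<in> lists S. length b = r} \<and>
           \<tau> \<in> lists S \<and> length \<tau> < r"
  using assms(2)
proof (induction "length \<sigma>" arbitrary: \<sigma> rule: less_induct)
  case less
  show ?case
  proof (cases "length \<sigma> < r")
    case True
    with less.prems show ?thesis by (intro exI[of _ "[]"] exI[of _ \<sigma>]) simp
  next
    case False
    have S: "take r \<sigma> \<in> lists S" "drop r \<sigma> \<in> lists S"
      using less.prems by (auto simp: in_lists_conv_set dest: in_set_takeD in_set_dropD)
    have len: "length (drop r \<sigma>) < length \<sigma>"
      using False assms(1) by simp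
    obtain bs \<tau> where bs: "drop r \<sigma> = concat bs @ \<tau>" "bs \<in> lists {b \<in> lists S. length b = r}"
      "\<tau> \<in> lists S" "length \<tau> < r"
      using less.hyps[OF len S(2)] by blast
    have "\<sigma> = concat (take r \<sigma> # bs) @ \<tau>"
      using append_take_drop_id[of r \<sigma>] bs(1) by simp
    moreover have "take r \<sigma> # bs \<in> lists {b \<in> lists S. length b = r}"
      using S(1) False bs(2) by simp
    ultimately show ?thesis using bs(3,4) by blast
  qed
qed

lemma digit_kernel_expansions:
  assumes "additive F"
  shows "digit_kernel (expansions F S r) (F ^^ r) A =
    (\<lambda>bs. kernel_set F A (concat bs)) ` lists {b \<in> lists S. length b = r}"
proof -
  have "kernel_set (F ^^ r) A (map (expansion_value F) bs) = kernel_set F A (concat bs)"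
    if "bs \<in> lists {b \<in> lists S. length b = r}" for bs
    using that kernel_set_concat[OF assms, of bs r] by auto
  then show ?thesis
    by (simp add: digit_kernel_def expansions_def lists_image image_image cong: image_cong)
qed

text \<open>Every kernel set for \<open>F\<close> arises from one for \<open>F ^^ r\<close> by
  reading fewer than \<open>r\<close> further digits, and \<open>S\<close> offers only finitely many
  such tails.\<close>

lemma finite_digit_kernel_funpow_iff:
  assumes "additive F" "finite S" "0 < r"
  shows "finite (digit_kernel (expansions F S r) (F ^^ r) A) \<longleftrightarrow> finite (digit_kernel S F A)"
    (is "finite ?K \<longleftrightarrow> _")
proof
  assume fin: "finite ?K"
  let ?R = "{\<tau> \<in> lists S. length \<tau> < r}"
  have "finite ?R"
    by (rule finite_subset[OF _ finite_lists_length_le[OF assms(2), of r]]) auto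
  moreover have "digit_kernel S F A \<subseteq> (\<lambda>(B, \<tau>). kernel_set F B \<tau>) ` (?K \<times> ?R)"
  proof
    fix B assume "B \<in> digit_kernel S F A"
    then obtain \<sigma> where \<sigma>: "\<sigma> \<in> lists S" "B = kernel_set F A \<sigma>"
      by (auto simp: digit_kernel_def)
    obtain bs \<tau> where bs: "\<sigma> = concat bs @ \<tau>" "bs \<in> lists {b \<in> lists S. length b = r}"
      "\<tau> \<in> lists S" "length \<tau> < r"
      using exists_block_decomposition[OF assms(3) \<sigma>(1)] by blast
    then show "B \<in> (\<lambda>(B, \<tau>). kernel_set F B \<tau>) ` (?K \<times> ?R)"
      unfolding digit_kernel_expansions[OF assms(1)] \<sigma>(2) bs(1) kernel_set_append[OF assms(1)]
      by (intro image_eqI[of _ _ "(kernel_set F A (concat bs), \<tau>)"]) auto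
  qed
  ultimately show "finite (digit_kernel S F A)"
    using fin by (meson finite_SigmaI finite_imageI finite_subset)
next
  assume "finite (digit_kernel S F A)"
  moreover have "?K \<subseteq> digit_kernel S F A"
    unfolding digit_kernel_expansions[OF assms(1)] digit_kernel_def[of S] by fastforce
  ultimately show "finite ?K" by (rule rev_finite_subset)
qed

lemma expansions_coset_representatives:
  assumes "additive F" and rep: "\<forall>x. \<exists>s\<in>S. s - x \<in> range F"
  shows "\<exists>t\<in>expansions F S r. t - x \<in> range (F ^^ r)"
proof (induction r arbitrary: x)
  case (Suc r)
  obtain s y where s: "s \<in> S" "s - x = F y"
    using rep by blast
  \<comment> \<open>Since \<open>x = s + F (- y)\<close>, the remaining digits have to represent the
    coset of \<open>- y\<close>.\<close>
  obtain t z where t: "t \<in> expansions F S r" "t - (- y) = (F ^^ r) z"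
    using Suc by blast
  have "s + F t - x = (s - x) + F t" by simp
  also have "\<dots> = F (t - (- y))"
    by (simp add: s additive.add[OF assms(1)] add.commute)
  also have "\<dots> = (F ^^ Suc r) z"
    by (simp only: t funpow.simps o_apply)
  finally show ?case
    using s(1) t(1) unfolding expansions_Suc[OF assms(1)] by blast
qed simp

section \<open>Automata and kernels\<close>

lemma regular_iff_finite_digit_kernel:
  assumes "additive G" and span: "\<forall>a. \<exists>\<sigma>\<in>lists \<Sigma>. a = expansion_value G \<sigma>"
  shows "regular_language \<Sigma> {\<sigma> \<in> lists \<Sigma>. expansion_value G \<sigma> \<in> A} \<longleftrightarrow>
    finite (digit_kernel \<Sigma> G A)"
proof
  assume "regular_language \<Sigma> {\<sigma> \<in> lists \<Sigma>. expansion_value G \<sigma> \<in> A}"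
  then obtain Q :: "nat set" and q0 \<delta> Acc where Q: "finite Q" "q0 \<in> Q"
    "\<forall>q\<in>Q. \<forall>a\<in>\<Sigma>. \<delta> q a \<in> Q"
    "{\<sigma> \<in> lists \<Sigma>. expansion_value G \<sigma> \<in> A} = {w \<in> lists \<Sigma>. foldl \<delta> q0 w \<in> Acc}"
    unfolding regular_language_def by blast
  have acc: "expansion_value G w \<in> A \<longleftrightarrow> foldl \<delta> q0 w \<in> Acc" if "w \<in> lists \<Sigma>" for w
    using that Q(4) by blast
  have state: "foldl \<delta> q0 w \<in> Q" if "w \<in> lists \<Sigma>" for w
    using that by (induction w rule: rev_induct) (use Q in auto)
  \<comment> \<open>The values accepted from state \<open>q\<close>. Since every element is the
    value of some suffix, the state reached by a prefix determines its kernel set.\<close>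
  define h where "h q = {expansion_value G \<tau> |\<tau>. \<tau> \<in> lists \<Sigma> \<and> foldl \<delta> q \<tau> \<in> Acc}" for q
  have "kernel_set G A \<sigma> = h (foldl \<delta> q0 \<sigma>)" if "\<sigma> \<in> lists \<Sigma>" for \<sigma>
  proof -
    have iff: "expansion_value G \<tau> \<in> kernel_set G A \<sigma> \<longleftrightarrow> foldl \<delta> (foldl \<delta> q0 \<sigma>) \<tau> \<in> Acc"
      if "\<tau> \<in> lists \<Sigma>" for \<tau>
      using acc[of "\<sigma> @ \<tau>"] that \<open>\<sigma> \<in> lists \<Sigma>\<close>
      by (simp add: kernel_set_def expansion_value_append[OF assms(1)])
    show ?thesis
    proof (rule set_eqI)
      fix x
      obtain \<tau> where "\<tau> \<in> lists \<Sigma>" "x = expansion_value G \<tau>"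
        using span by blast
      then show "x \<in> kernel_set G A \<sigma> \<longleftrightarrow> x \<in> h (foldl \<delta> q0 \<sigma>)"
        unfolding h_def mem_Collect_eq using iff by metis
    qed
  qed
  then have "digit_kernel \<Sigma> G A \<subseteq> h ` Q"
    unfolding digit_kernel_def using state by blast
  then show "finite (digit_kernel \<Sigma> G A)"
    using Q(1) finite_surj by blast
next
  let ?K = "digit_kernel \<Sigma> G A"
  assume fin: "finite ?K"
  \<comment> \<open>The automaton built here has the kernel sets as states; \<open>f\<close> codes
    them as natural numbers.\<close>
  then obtain f :: "'a set \<Rightarrow> nat" where f: "inj_on f ?K"
    by (auto dest: finite_imp_inj_to_nat_seg)
  define \<delta> where "\<delta> q a = f (kernel_set G (inv_into ?K f q) [a])" for q a
  have K: "kernel_set G A w \<in> ?K" if "w \<in> lists \<Sigma>" for w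
    using that by (simp add: digit_kernel_def)
  have \<delta>: "\<delta> (f (kernel_set G A w)) a = f (kernel_set G A (w @ [a]))" if "w \<in> lists \<Sigma>" for w a
    using that by (simp add: \<delta>_def inv_into_f_f[OF f K] kernel_set_append[OF assms(1)])
  have run: "foldl \<delta> (f A) w = f (kernel_set G A w)" if "w \<in> lists \<Sigma>" for w
    using that by (induction w rule: rev_induct) (auto simp: \<delta>)
  \<comment> \<open>The empty suffix has value 0, so the accepting states are the kernel sets
    containing 0.\<close>
  have mem: "0 \<in> kernel_set G A w \<longleftrightarrow> expansion_value G w \<in> A" for w
    by (simp add: kernel_set_def additive.zero[OF additive_funpow[OF assms(1)]])
  have "foldl \<delta> (f A) w \<in> f ` {B \<in> ?K. 0 \<in> B} \<longleftrightarrow> expansion_value G w \<in> A"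
    if "w \<in> lists \<Sigma>" for w
    using inj_on_image_mem_iff[OF f K[OF that], of "{B \<in> ?K. 0 \<in> B}"] K[OF that] mem
      by (simp add: run[OF that])
  then have "{\<sigma> \<in> lists \<Sigma>. expansion_value G \<sigma> \<in> A} =
      {w \<in> lists \<Sigma>. foldl \<delta> (f A) w \<in> f ` {B \<in> ?K. 0 \<in> B}}"
    by blast
  moreover have "\<delta> q a \<in> f ` ?K" if q: "q \<in> f ` ?K" and "a \<in> \<Sigma>" for q a
  proof -
    obtain w where "w \<in> lists \<Sigma>" "q = f (kernel_set G A w)"
      using q by (auto simp: digit_kernel_def)
    then show ?thesis using \<delta> K[of "w @ [a]"] \<open>a \<in> \<Sigma>\<close> by auto
  qed
  moreover have "f A \<in> f ` ?K" using K[of "[]"] by simp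
  ultimately show "regular_language \<Sigma> {\<sigma> \<in> lists \<Sigma>. expansion_value G \<sigma> \<in> A}"
    unfolding regular_language_def using fin
    by (intro exI[of _ "f ` ?K"] exI[of _ "f A"] exI[of _ \<delta>] exI[of _ "f ` {B \<in> ?K. 0 \<in> B}"]) auto
qed

theorem theorem4p2:
  fixes F :: "'a::ab_group_add \<Rightarrow> 'a" and S A :: "'a set"
  assumes "infinite (UNIV :: 'a set)"
    and "additive F" and "inj F"
    and "\<exists>r>0. \<exists>\<Sigma>. spanning_set (F ^^ r) \<Sigma>"
    and "finite S" and "\<forall>x. \<exists>s\<in>S. s - x \<in> range F"
  shows "automatic F A \<longleftrightarrow> finite (digit_kernel S F A)"
proof -
  \<comment> \<open>Proved for every \<open>r\<close> and \<Sigma>, this serves both directions: one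
    takes the spanning set from \<open>automatic\<close>, the other the one assumed to
    exist.\<close>
  have "regular_language \<Sigma> {\<sigma> \<in> lists \<Sigma>. expansion_value (F ^^ r) \<sigma> \<in> A} \<longleftrightarrow>
      finite (digit_kernel S F A)" if "0 < r" "spanning_set (F ^^ r) \<Sigma>" for r \<Sigma>
  proof -
    note G = additive_funpow[OF assms(2), of r]
    have "regular_language \<Sigma> {\<sigma> \<in> lists \<Sigma>. expansion_value (F ^^ r) \<sigma> \<in> A} \<longleftrightarrow>
        finite (digit_kernel \<Sigma> (F ^^ r) A)"
      using that(2) by (intro regular_iff_finite_digit_kernel G) (simp add: spanning_set_def)
    also have "\<dots> \<longleftrightarrow> finite (digit_kernel (expansions F S r) (F ^^ r) A)"
      using expansions_coset_representatives[OF assms(2,6)]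
      by (intro finite_digit_kernel_spanning_iff G that finite_expansions assms) blast
    also have "\<dots> \<longleftrightarrow> finite (digit_kernel S F A)"
      using that(1) by (intro finite_digit_kernel_funpow_iff assms)
    finally show ?thesis .
  qed
  then show ?thesis
    using assms(4) unfolding automatic_def by blast
qed

end
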